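(* There exist sets of three paths for which every monotone simultaneous embedding needs a grid whose size is exponential in the number of vertices of the paths. That is, there are a constant $c>1$ and infinitely many integers $n$ for which there exists a set of three directed spanning paths on a common set $V$ of $n$ vertices such that the set admits a monotone simultaneous embedding, and in every monotone simultaneous embedding of it in which all vertices are placed at points of an integer grid with $W$ columns and $H$ rows, one has $\max(W,H)\ge c^{n}$.
   Context: A directed spanning path on $V$ is a simple directed path visiting every vertex of $V$ exactly once, directed from one end to the other. For a nonzero vector $\vec v\in\mathbb{R}^2$, a drawing of a digraph (vertices are distinct points, edges are curves) is $\vec v$-monotone if every edge is drawn as a directed curve that is monotonically increasing in direction $\vec v$. Given digraphs $G_1,\dots,G_k$ on the same vertex set $V$ and vectors $\vec v_1,\dots,\vec v_k$, a $\{\vec v_1,\dots,\vec v_k\}$-monotone simultaneous embedding consists of planar drawings $\Gamma_1,\dots,\Gamma_k$ such that $\Gamma_i$ is a $\vec v_i$-monotone drawing of $G_i$ for each $i$, and each vertex of $V$ is represented by the same point in all the drawings. A monotone simultaneous embedding is a $\{\vec v_1,\dots,\vec v_k\}$-monotone simultaneous embedding for some vectors $\vec v_1,\dots,\vec v_k$. An integer grid with $W$ columns and $H$ rows is a set of points of the form $\{a+1,\dots,a+W\}\times\{b+1,\dots,b+H\}$ with $a,b\in\mathbb{Z}$. *)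

theory Defs
  imports "HOL-Analysis.Analysis" "Graph_Theory.Pair_Digraph"
begin

type_synonym plane = "real \<times> real"

definition directed_spanning_path :: "'a set \<Rightarrow> 'a pair_pre_digraph \<Rightarrow> bool" where
  "directed_spanning_path V G \<longleftrightarrow>
     pverts G = V \<and>
     (\<exists>u p v. pre_digraph.apath (with_proj G) u p v \<and>
              set (pre_digraph.awalk_verts (with_proj G) u p) = V \<and>
              parcs G = set p)"

text \<open>
  A drawing is given by the positions of the vertices and, for each arc, a curve parametrised
  from its tail to its head.  The condition \<open>simple_path\<close> also covers loops, drawn as simple
  closed curves.
\<close>

definition is_drawing ::
  "'a pair_pre_digraph \<Rightarrow> ('a \<Rightarrow> plane) \<Rightarrow> ('a \<times> 'a \<Rightarrow> real \<Rightarrow> plane) \<Rightarrow> bool" where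
  "is_drawing G pos \<gamma> \<longleftrightarrow>
     inj_on pos (pverts G) \<and>
     (\<forall>e \<in> parcs G. simple_path (\<gamma> e) \<and>
        pathstart (\<gamma> e) = pos (fst e) \<and> pathfinish (\<gamma> e) = pos (snd e))"

definition planar_drawing ::
  "'a pair_pre_digraph \<Rightarrow> ('a \<Rightarrow> plane) \<Rightarrow> ('a \<times> 'a \<Rightarrow> real \<Rightarrow> plane) \<Rightarrow> bool" where
  "planar_drawing G pos \<gamma> \<longleftrightarrow>
     is_drawing G pos \<gamma> \<and>
     (\<forall>e \<in> parcs G. \<forall>w \<in> pverts G.
        pos w \<in> path_image (\<gamma> e) \<longrightarrow> w = fst e \<or> w = snd e) \<and>
     (\<forall>e \<in> parcs G. \<forall>f \<in> parcs G. e \<noteq> f \<longrightarrow>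
        path_image (\<gamma> e) \<inter> path_image (\<gamma> f) \<subseteq> pos ` ({fst e, snd e} \<inter> {fst f, snd f}))"

definition monotone_drawing ::
  "plane \<Rightarrow> 'a pair_pre_digraph \<Rightarrow> ('a \<times> 'a \<Rightarrow> real \<Rightarrow> plane) \<Rightarrow> bool" where
  "monotone_drawing v G \<gamma> \<longleftrightarrow> (\<forall>e \<in> parcs G. strict_mono_on {0..1} (\<lambda>t. v \<bullet> \<gamma> e t))"

text \<open>
  The \<open>i\<close>-th drawing uses the shared vertex positions \<open>pos\<close> and the curves \<open>\<gamma>s ! i\<close>.
  The directions are required to be nonzero, but not to be distinct or independent.
\<close>

definition directed_monotone_simultaneous_embedding ::
  "plane list \<Rightarrow> 'a set \<Rightarrow> 'a pair_pre_digraph list \<Rightarrow>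
   ('a \<Rightarrow> plane) \<Rightarrow> ('a \<times> 'a \<Rightarrow> real \<Rightarrow> plane) list \<Rightarrow> bool" where
  "directed_monotone_simultaneous_embedding vs V Gs pos \<gamma>s \<longleftrightarrow>
     length vs = length Gs \<and> length \<gamma>s = length Gs \<and>
     (\<forall>i < length Gs.
        vs ! i \<noteq> 0 \<and> pverts (Gs ! i) = V \<and>
        planar_drawing (Gs ! i) pos (\<gamma>s ! i) \<and>
        monotone_drawing (vs ! i) (Gs ! i) (\<gamma>s ! i))"

definition monotone_simultaneous_embedding ::
  "'a set \<Rightarrow> 'a pair_pre_digraph list \<Rightarrow>
   ('a \<Rightarrow> plane) \<Rightarrow> ('a \<times> 'a \<Rightarrow> real \<Rightarrow> plane) list \<Rightarrow> bool" where
  "monotone_simultaneous_embedding V Gs pos \<gamma>s \<longleftrightarrow>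
     (\<exists>vs. directed_monotone_simultaneous_embedding vs V Gs pos \<gamma>s)"

definition integer_grid :: "int \<Rightarrow> int \<Rightarrow> nat \<Rightarrow> nat \<Rightarrow> plane set" where
  "integer_grid a b W H =
     (real_of_int ` {a + 1..a + int W}) \<times> (real_of_int ` {b + 1..b + int H})"

end

theory Submission
  imports Defs
begin

text \<open>
  A path with a monotone drawing lists the vertices in increasing order of a linear functional, so
  three paths prescribe the orders of the vertices under three functionals on the plane.  These
  are linearly dependent, and the vertices \<open>O, A\<^sub>0, B\<^sub>0, C\<^sub>0\<close> force the signs of the dependency,
  so that up to positive scaling the functionals are \<open>X\<close>, \<open>Y\<close> and \<open>X - Y\<close>, all vanishing at \<open>O\<close>.
  Let the orders make \<open>A\<^sub>j\<^sub>+\<^sub>1\<close> exceed \<open>C\<^sub>j\<close> in \<open>X\<close> and stay below \<open>B\<^sub>j\<close> in \<open>X - Y\<close>, let \<open>B\<^sub>j\<close> and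
  \<open>C\<^sub>j\<close> exceed \<open>A\<^sub>j\<close> in \<open>Y\<close>, and let \<open>X (B\<^sub>j) < 0\<close> and \<open>Y (C\<^sub>j) < X (C\<^sub>j)\<close>.  Then
  \<open>Y (A\<^sub>j\<^sub>+\<^sub>1) > X (C\<^sub>j) + Y (B\<^sub>j) - X (B\<^sub>j) > 2 Y (A\<^sub>j)\<close>.  Hence the area spanned by \<open>A\<^sub>k\<close> and \<open>B\<^sub>k\<close>
  is exponentially larger than that spanned by \<open>A\<^sub>0\<close> and \<open>B\<^sub>0\<close>.  Ratios of areas do not depend on
  the functionals, and on the integer grid the smaller area is at least \<open>1\<close> while the larger one
  is at most quadratic in the side length.
\<close>

section \<open>Paths as sorted lists\<close>

definition path_arcs :: "'a list \<Rightarrow> ('a \<times> 'a) list" where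
  "path_arcs xs = zip xs (tl xs)"

definition path_graph :: "'a list \<Rightarrow> 'a pair_pre_digraph" where
  "path_graph xs = \<lparr>pverts = set xs, parcs = set (path_arcs xs)\<rparr>"

lemma path_arcs_simps [simp]:
  "path_arcs [] = []"
  "path_arcs [x] = []"
  "path_arcs (x # y # xs) = (x, y) # path_arcs (y # xs)"
  by (simp_all add: path_arcs_def)

lemma path_graph_simps [simp]:
  "pverts (path_graph xs) = set xs"
  "parcs (path_graph xs) = set (path_arcs xs)"
  by (simp_all add: path_graph_def)

lemma pcas_path_arcs: "xs \<noteq> [] \<Longrightarrow> pcas (hd xs) (path_arcs xs) (last xs)"
  by (induction xs rule: induct_list012) auto

lemma pawalk_verts_path_arcs: "xs \<noteq> [] \<Longrightarrow> pawalk_verts (hd xs) (path_arcs xs) = xs"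
  by (induction xs rule: induct_list012) auto

lemma directed_spanning_path_path_graph:
  assumes "xs \<noteq> []" "distinct xs"
  shows "directed_spanning_path (set xs) (path_graph xs)"
  unfolding directed_spanning_path_def pre_digraph.apath_def pre_digraph.awalk_def
    cas_with_proj_eq awalk_verts_with_proj_eq
  using assms pcas_path_arcs[OF assms(1)] pawalk_verts_path_arcs[OF assms(1)]
  by (intro conjI exI[of _ "hd xs"] exI[of _ "path_arcs xs"] exI[of _ "last xs"]) auto

lemma ex_sorted_list:
  fixes f :: "'a \<Rightarrow> real"
  assumes "finite V" "inj_on f V"
  obtains xs where "set xs = V" "distinct xs" "sorted_wrt (\<lambda>a b. f a < f b) xs"
proof -
  obtain ys where ys: "set ys = V" "distinct ys"
    using finite_distinct_list[OF assms(1)] by auto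
  define xs where "xs = sort_key f ys"
  have xs: "set xs = V" "distinct xs" "sorted (map f xs)"
    using ys by (simp_all add: xs_def)
  have "distinct (map f xs)"
    using xs assms(2) by (simp add: distinct_map)
  then have "sorted_wrt (<) (map f xs)"
    using xs(3) by (simp add: strict_sorted_iff)
  then have "sorted_wrt (\<lambda>a b. f a < f b) xs"
    by (simp add: sorted_wrt_map)
  with xs that show thesis by blast
qed

text \<open>Arcs join neighbours of the sorted list, so no vertex has a value strictly between those
  of the two ends. This confines straight segments to strips without common interior.\<close>

lemma path_arcs_sorted:
  fixes f :: "'a \<Rightarrow> real"
  assumes "sorted_wrt (\<lambda>a b. f a < f b) xs" "(a, b) \<in> set (path_arcs xs)"
  shows "a \<in> set xs \<and> b \<in> set xs \<and> f a < f b \<and> (\<forall>c\<in>set xs. (f c \<le> f a \<and> (f c = f a \<longrightarrow> c = a))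
    \<or> (f b \<le> f c \<and> (f c = f b \<longrightarrow> c = b)))"
  using assms by (induction xs rule: induct_list012) (auto; fastforce)+

text \<open>Transitivity along the path: comparisons on single arcs already fix the order of all
  vertices.\<close>

lemma sorted_wrt_if_path_arcs:
  fixes g :: "'a \<Rightarrow> real"
  assumes "\<And>a b. (a, b) \<in> set (path_arcs xs) \<Longrightarrow> g a < g b"
  shows "sorted_wrt (\<lambda>a b. g a < g b) xs"
  using assms
proof (induction xs rule: induct_list012)
  case (3 x y zs)
  have "sorted_wrt (\<lambda>a b. g a < g b) (y # zs)" by (rule 3(2)) (simp add: 3(3))
  moreover have "g x < g y" by (rule 3(3)) simp
  ultimately show ?case by auto
qed simp_all

text \<open>Both functions increase along the same list, so \<open>f p < f q\<close> means that
  \<open>p\<close> stands before \<open>q\<close>, which in turn settles the comparison under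
  \<open>g\<close>.\<close>

lemma sorted_wrt_transfer:
  fixes f g :: "'a \<Rightarrow> real"
  assumes "sorted_wrt (\<lambda>a b. f a < f b) xs" "sorted_wrt (\<lambda>a b. g a < g b) xs"
    and "p \<in> set xs" "q \<in> set xs" "f p < f q"
  shows "g p < g q"
  using assms by (induction xs) (auto dest: less_asym)

section \<open>Straight-line drawings\<close>

lemma inner_linepath:
  "v \<bullet> linepath a b t = v \<bullet> a + t * (v \<bullet> b - v \<bullet> a)"
  by (simp add: linepath_def inner_add_right inner_diff_right algebra_simps)

lemma linepath_inner_range:
  assumes "v \<bullet> a < v \<bullet> b" "z \<in> path_image (linepath a b)"
  shows "v \<bullet> a \<le> v \<bullet> z" "v \<bullet> z \<le> v \<bullet> b" "v \<bullet> z = v \<bullet> a \<Longrightarrow> z = a" "v \<bullet> z = v \<bullet> b \<Longrightarrow> z = b"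
proof -
  obtain t where t: "0 \<le> t" "t \<le> 1" "z = linepath a b t"
    using assms(2) unfolding path_image_def by auto
  have vz: "v \<bullet> z = v \<bullet> a + t * (v \<bullet> b - v \<bullet> a)"
    using t inner_linepath by blast
  show "v \<bullet> a \<le> v \<bullet> z" using vz t assms(1) by simp
  have "t * (v \<bullet> b - v \<bullet> a) \<le> 1 * (v \<bullet> b - v \<bullet> a)"
    using t assms(1) by (intro mult_right_mono) auto
  then show "v \<bullet> z \<le> v \<bullet> b" using vz by simp
  show "z = a" if "v \<bullet> z = v \<bullet> a"
  proof -
    have "t = 0" using that vz assms(1) by simp
    then show ?thesis using t by (simp add: linepath_def)
  qed
  show "z = b" if "v \<bullet> z = v \<bullet> b"
  proof -
    have "(1 - t) * (v \<bullet> b - v \<bullet> a) = 0" using that vz by (simp add: algebra_simps)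
    then have "t = 1" using assms(1) by simp
    then show ?thesis using t by (simp add: linepath_def)
  qed
qed

text \<open>Each segment lies in the strip between two neighbouring levels of \<open>v\<close>. The
  strips of distinct arcs share at most a level line, and only a common end vertex can lie there on
  both segments.\<close>

lemma straight_line_drawing:
  fixes pos :: "'a \<Rightarrow> plane"
  assumes sorted: "sorted_wrt (\<lambda>a b. v \<bullet> pos a < v \<bullet> pos b) xs"
  defines "\<gamma> \<equiv> \<lambda>e. linepath (pos (fst e)) (pos (snd e))"
  shows "planar_drawing (path_graph xs) pos \<gamma>" "monotone_drawing v (path_graph xs) \<gamma>"
proof -
  let ?f = "\<lambda>a. v \<bullet> pos a"
  note arc = path_arcs_sorted[OF sorted]
  have inj: "a = b" if "a \<in> set xs" "b \<in> set xs" "?f a = ?f b" for a b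
    using sorted that by (induction xs) auto
  have drawing: "is_drawing (path_graph xs) pos \<gamma>"
    unfolding is_drawing_def
  proof (intro conjI ballI)
    show "inj_on pos (pverts (path_graph xs))"
      by (rule inj_onI) (auto intro: inj)
    fix e assume "e \<in> parcs (path_graph xs)"
    then have "pos (fst e) \<noteq> pos (snd e)"
      using arc[of "fst e" "snd e"] by auto
    then show "simple_path (\<gamma> e)" by (simp add: \<gamma>_def simple_path_linepath)
  qed (simp_all add: \<gamma>_def)
  have range: "?f (fst e) \<le> v \<bullet> z" "v \<bullet> z \<le> ?f (snd e)"
    "v \<bullet> z = ?f (fst e) \<Longrightarrow> z = pos (fst e)" "v \<bullet> z = ?f (snd e) \<Longrightarrow> z = pos (snd e)"
    if "e \<in> set (path_arcs xs)" "z \<in> path_image (\<gamma> e)" for e z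
    using linepath_inner_range[of v "pos (fst e)" "pos (snd e)" z] that arc[of "fst e" "snd e"]
    by (auto simp: \<gamma>_def)
  have ends: "w = fst e \<or> w = snd e"
    if "e \<in> set (path_arcs xs)" "w \<in> set xs" "pos w \<in> path_image (\<gamma> e)" for e w
    using range(1,2)[OF that(1,3)] arc[of "fst e" "snd e"] that by force
  have meet: "z \<in> pos ` ({fst e, snd e} \<inter> {fst g, snd g})"
    if eg: "e \<in> set (path_arcs xs)" "g \<in> set (path_arcs xs)" "?f (snd e) \<le> ?f (fst g)"
      and z: "z \<in> path_image (\<gamma> e)" "z \<in> path_image (\<gamma> g)" for e g z
  proof -
    have eq: "v \<bullet> z = ?f (snd e)" "v \<bullet> z = ?f (fst g)"
      using range(2)[OF eg(1) z(1)] range(1)[OF eg(2) z(2)] eg(3) by linarith+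
    have "snd e = fst g"
      using eq arc[of "fst e" "snd e"] arc[of "fst g" "snd g"] eg(1,2) by (intro inj) auto
    then show ?thesis using range(4)[OF eg(1) z(1) eq(1)] by auto
  qed
  have separated: "?f (snd e) \<le> ?f (fst g) \<or> ?f (snd g) \<le> ?f (fst e)"
    if eg: "e \<in> set (path_arcs xs)" "g \<in> set (path_arcs xs)" "e \<noteq> g" for e g
  proof -
    have e: "fst e \<in> set xs" "snd e \<in> set xs" "?f (fst e) < ?f (snd e)"
      "\<And>c. c \<in> set xs \<Longrightarrow> ?f c \<le> ?f (fst e) \<or> ?f (snd e) \<le> ?f c"
      using arc[of "fst e" "snd e"] eg(1) by auto
    have g: "fst g \<in> set xs" "snd g \<in> set xs" "?f (fst g) < ?f (snd g)"
      "\<And>c. c \<in> set xs \<Longrightarrow> ?f c \<le> ?f (fst g) \<or> ?f (snd g) \<le> ?f c"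
      using arc[of "fst g" "snd g"] eg(2) by auto
    \<comment> \<open>Levels determine vertices, so distinct arcs differ in an end level. As no end
      of one arc lies strictly inside the strip of the other, the strips cannot overlap.\<close>
    have "?f (fst e) \<noteq> ?f (fst g) \<or> ?f (snd e) \<noteq> ?f (snd g)"
      using inj e g eg(3) prod_eqI by metis
    then show ?thesis
      using e(3) g(3) e(4)[OF g(1)] e(4)[OF g(2)] g(4)[OF e(1)] g(4)[OF e(2)] by linarith
  qed
  have cross: "path_image (\<gamma> e) \<inter> path_image (\<gamma> g) \<subseteq> pos ` ({fst e, snd e} \<inter> {fst g, snd g})"
    if "e \<in> set (path_arcs xs)" "g \<in> set (path_arcs xs)" "e \<noteq> g" for e g
    using separated[OF that] meet[of e g] meet[of g e] that by blast
  show "planar_drawing (path_graph xs) pos \<gamma>"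
    unfolding planar_drawing_def using drawing ends cross by auto
  show "monotone_drawing v (path_graph xs) \<gamma>"
    unfolding monotone_drawing_def
    using arc by (auto simp: \<gamma>_def inner_linepath intro!: strict_mono_onI)
qed

text \<open>Comparing the parameters 0 and 1 turns a condition on arbitrary curves into one on
  vertex positions alone.\<close>

lemma monotone_drawing_arc_less:
  assumes "is_drawing G pos \<gamma>" "monotone_drawing v G \<gamma>" "(a, b) \<in> parcs G"
  shows "v \<bullet> pos a < v \<bullet> pos b"
proof -
  have "v \<bullet> \<gamma> (a, b) 0 < v \<bullet> \<gamma> (a, b) 1"
    using assms(2,3) unfolding monotone_drawing_def
    by (intro strict_mono_onD[of "{0..1}" "\<lambda>t. v \<bullet> \<gamma> (a, b) t"]) auto
  moreover have "\<gamma> (a, b) 0 = pos a" "\<gamma> (a, b) 1 = pos b"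
    using assms(1,3) unfolding is_drawing_def by (auto simp: pathstart_def pathfinish_def)
  ultimately show ?thesis by simp
qed

section \<open>The spiral\<close>

text \<open>
  Vertex \<open>0\<close> is \<open>O\<close>, and \<open>3 j + 1\<close>, \<open>3 j + 2\<close>, \<open>3 j + 3\<close> are \<open>A\<^sub>j\<close>, \<open>B\<^sub>j\<close>, \<open>C\<^sub>j\<close>.  The factor
  \<open>10 ^ m\<close> makes the absolute values of all three coordinates strictly increasing in \<open>m\<close>.
\<close>

definition spiral_x :: "nat \<Rightarrow> real" where
  "spiral_x m = (if m = 0 then 0 else
     (if m mod 3 = 1 then 1 else if m mod 3 = 2 then - 1 else 4) * 10 ^ m)"

definition spiral_y :: "nat \<Rightarrow> real" where
  "spiral_y m = (if m = 0 then 0 else 2 * 10 ^ m)"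

text \<open>The third functional in the normal form \<open>X - Y\<close>. The multipliers in
  \<open>spiral_x\<close> and \<open>spiral_y\<close> make it negative at the points
  \<open>A\<close> and \<open>B\<close> and positive at the points \<open>C\<close>.\<close>

definition spiral_z :: "nat \<Rightarrow> real" where
  "spiral_z m = spiral_x m - spiral_y m"

lemma spiral_0 [simp]: "spiral_x 0 = 0" "spiral_y 0 = 0" "spiral_z 0 = 0"
  by (simp_all add: spiral_x_def spiral_y_def spiral_z_def)

lemma spiral_values [simp]:
  "spiral_x (3 * j + 1) = 10 ^ (3 * j + 1)"
  "spiral_x (3 * j + 2) = - (10 ^ (3 * j + 2))"
  "spiral_x (3 * j + 3) = 4 * 10 ^ (3 * j + 3)"
  "spiral_y (3 * j + 1) = 2 * 10 ^ (3 * j + 1)"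
  "spiral_y (3 * j + 2) = 2 * 10 ^ (3 * j + 2)"
  "spiral_y (3 * j + 3) = 2 * 10 ^ (3 * j + 3)"
  "spiral_z (3 * j + 1) = - (10 ^ (3 * j + 1))"
  "spiral_z (3 * j + 2) = - 3 * 10 ^ (3 * j + 2)"
  "spiral_z (3 * j + 3) = 2 * 10 ^ (3 * j + 3)"
proof -
  have m: "(3 * j + 1) mod 3 = 1" "(3 * j + 2) mod 3 = 2" "(3 * j + 3) mod 3 = 0"
    by presburger+
  show "spiral_x (3 * j + 1) = 10 ^ (3 * j + 1)"
  "spiral_x (3 * j + 2) = - (10 ^ (3 * j + 2))"
  "spiral_x (3 * j + 3) = 4 * 10 ^ (3 * j + 3)"
  "spiral_y (3 * j + 1) = 2 * 10 ^ (3 * j + 1)"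
  "spiral_y (3 * j + 2) = 2 * 10 ^ (3 * j + 2)"
  "spiral_y (3 * j + 3) = 2 * 10 ^ (3 * j + 3)"
  "spiral_z (3 * j + 1) = - (10 ^ (3 * j + 1))"
  "spiral_z (3 * j + 2) = - 3 * 10 ^ (3 * j + 2)"
  "spiral_z (3 * j + 3) = 2 * 10 ^ (3 * j + 3)"
    unfolding spiral_z_def spiral_x_def spiral_y_def m by simp_all
qed

text \<open>Since 4 < 10, the intervals from \<open>10 ^ m\<close> to \<open>4 * 10 ^ m\<close> are
  pairwise disjoint; the value 0 at index 0 lies below all of them.\<close>

lemma inj_if_decimal_growth:
  fixes f :: "nat \<Rightarrow> real"
  assumes "f 0 = 0" "\<And>m. m > 0 \<Longrightarrow> 10 ^ m \<le> \<bar>f m\<bar> \<and> \<bar>f m\<bar> \<le> 4 * 10 ^ m"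
  shows "inj f"
proof -
  have "\<bar>f m\<bar> < \<bar>f (Suc m)\<bar>" for m
  proof (cases "m = 0")
    case False
    have "\<bar>f m\<bar> \<le> 4 * 10 ^ m" using assms(2) False by blast
    also have "\<dots> < 10 ^ Suc m" by simp
    also have "\<dots> \<le> \<bar>f (Suc m)\<bar>" using assms(2)[of "Suc m"] by blast
    finally show ?thesis .
  qed (use assms(1) assms(2)[of 1] in auto)
  then have "strict_mono (\<lambda>m. \<bar>f m\<bar>)" by (simp add: strict_mono_Suc_iff)
  then have "inj (\<lambda>m. \<bar>f m\<bar>)" by (rule strict_mono_imp_inj_on)
  then show ?thesis unfolding inj_def by metis
qed

lemma inj_spiral: "inj spiral_x" "inj spiral_y" "inj spiral_z"
  by (rule inj_if_decimal_growth; simp add: spiral_x_def spiral_y_def spiral_z_def)+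

section \<open>Exponential growth\<close>

text \<open>The determinant: the signed area of the parallelogram spanned by the two
  vectors.\<close>

definition cross2 :: "plane \<Rightarrow> plane \<Rightarrow> real" where
  "cross2 u w = fst u * snd w - snd u * fst w"

lemma inner_plane: "u \<bullet> (w :: plane) = fst u * fst w + snd u * snd w"
  by (cases u; cases w) simp

text \<open>Cramer's rule for the linear dependency of three vectors in the plane.\<close>

lemma cross2_three_directions:
  "cross2 u v * (w \<bullet> p) = cross2 w v * (u \<bullet> p) + cross2 u w * (v \<bullet> p)"
  by (simp add: cross2_def inner_plane algebra_simps)

text \<open>Multiplicativity of the determinant, for the matrix with rows \<open>u\<close>,
  \<open>v\<close> times the matrix with columns \<open>p\<close>, \<open>q\<close>.\<close>

lemma cross2_inner:
  "(u \<bullet> p) * (v \<bullet> q) - (v \<bullet> p) * (u \<bullet> q) = cross2 u v * cross2 p q"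
  by (simp add: cross2_def inner_plane algebra_simps)

text \<open>Points are taken relative to \<open>O\<close>, so comparisons with \<open>O\<close>
  become sign conditions. The directions stay arbitrary.\<close>

locale spiral =
  fixes k :: nat and A B C :: "nat \<Rightarrow> plane" and v1 v2 v3 :: plane
  assumes A_pos: "\<And>j. j \<le> k \<Longrightarrow> v1 \<bullet> A j > 0 \<and> v2 \<bullet> A j > 0 \<and> v3 \<bullet> A j < 0"
    and B_pos: "\<And>j. j \<le> k \<Longrightarrow> v1 \<bullet> B j < 0 \<and> v2 \<bullet> A j < v2 \<bullet> B j \<and> v3 \<bullet> B j < 0"
    and C_pos: "\<And>j. j \<le> k \<Longrightarrow> v1 \<bullet> C j > 0 \<and> v2 \<bullet> A j < v2 \<bullet> C j \<and> v3 \<bullet> C j > 0"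
    and A_Suc: "\<And>j. Suc j \<le> k \<Longrightarrow> v1 \<bullet> C j < v1 \<bullet> A (Suc j) \<and> v3 \<bullet> A (Suc j) < v3 \<bullet> B j"
begin

lemma cross2_nonzero: "cross2 v1 v2 \<noteq> 0"
proof
  assume "cross2 v1 v2 = 0"
  then have "(v1 \<bullet> A 0) * (v2 \<bullet> B 0) = (v2 \<bullet> A 0) * (v1 \<bullet> B 0)"
    using cross2_inner[of v1 "A 0" v2 "B 0"] by simp
  moreover have "(v1 \<bullet> A 0) * (v2 \<bullet> B 0) > 0"
    using A_pos[of 0] B_pos[of 0] by (intro mult_pos_pos) auto
  moreover have "(v2 \<bullet> A 0) * (v1 \<bullet> B 0) < 0"
    using A_pos[of 0] B_pos[of 0] by (intro mult_pos_neg) auto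
  ultimately show False by simp
qed

text \<open>Cramer's rule supplies the coefficients. If \<beta> were not positive, \<alpha> times
  \<open>v1\<close> would be negative at both \<open>A 0\<close> and \<open>B 0\<close>, where
  \<open>v1\<close> has opposite signs. Then \<open>C 0\<close> forces \<alpha> > 0.\<close>

lemma third_direction:
  obtains \<alpha> \<beta> where "\<alpha> > 0" "\<beta> > 0" "\<And>p. v3 \<bullet> p = \<alpha> * (v1 \<bullet> p) - \<beta> * (v2 \<bullet> p)"
proof -
  define \<alpha> where "\<alpha> = cross2 v3 v2 / cross2 v1 v2"
  define \<beta> where "\<beta> = - cross2 v1 v3 / cross2 v1 v2"
  have lin: "v3 \<bullet> p = \<alpha> * (v1 \<bullet> p) - \<beta> * (v2 \<bullet> p)" for p
    using cross2_three_directions[of v1 v2 v3 p] cross2_nonzero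
    by (simp add: \<alpha>_def \<beta>_def field_simps)
  have "\<beta> > 0"
  proof (rule ccontr)
    assume "\<not> \<beta> > 0"
    then have "\<beta> * (v2 \<bullet> A 0) \<le> 0" "\<beta> * (v2 \<bullet> B 0) \<le> 0"
      using A_pos[of 0] B_pos[of 0] by (auto intro!: mult_nonpos_nonneg)
    then have "\<alpha> * (v1 \<bullet> A 0) < 0" "\<alpha> * (v1 \<bullet> B 0) < 0"
      using lin[of "A 0"] lin[of "B 0"] A_pos[of 0] B_pos[of 0] by auto
    then show False
      using A_pos[of 0] B_pos[of 0] by (auto simp: mult_less_0_iff)
  qed
  then have "\<beta> * (v2 \<bullet> C 0) > 0"
    using A_pos[of 0] C_pos[of 0] by auto
  then have "\<alpha> * (v1 \<bullet> C 0) > 0"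
    using lin[of "C 0"] C_pos[of 0] by auto
  then have "\<alpha> > 0"
    using C_pos[of 0] by (simp add: zero_less_mult_iff)
  with \<open>\<beta> > 0\<close> lin that show thesis by blast
qed

text \<open>Up to one common factor, the first area is at most \<open>2 * M * M\<close> and the last
  at least \<open>4 ^ r\<close> times that, where \<open>M\<close> is the rescaled
  \<open>v2\<close>-height of \<open>A 1\<close>.\<close>

lemma cross2_growth:
  assumes k: "k = r + 2"
  shows "cross2 (A 0) (B 0) \<noteq> 0"
    and "4 ^ r * \<bar>cross2 (A 0) (B 0)\<bar> \<le> \<bar>cross2 (A k) (B k)\<bar>"
proof -
  obtain \<alpha> \<beta> where ab: "\<alpha> > 0" "\<beta> > 0" "\<And>p. v3 \<bullet> p = \<alpha> * (v1 \<bullet> p) - \<beta> * (v2 \<bullet> p)"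
    using third_direction by blast
  \<comment> \<open>Absorbing the coefficients turns the third functional into \<open>X - Y\<close>;
    \<kappa> is the factor by which this change of coordinates multiplies areas.\<close>
  define X where "X p = \<alpha> * (v1 \<bullet> p)" for p
  define Y where "Y p = \<beta> * (v2 \<bullet> p)" for p
  define \<kappa> where "\<kappa> = \<alpha> * \<beta> * cross2 v1 v2"
  have "X p * Y q - Y p * X q = \<alpha> * \<beta> * ((v1 \<bullet> p) * (v2 \<bullet> q) - (v2 \<bullet> p) * (v1 \<bullet> q))" for p q
    unfolding X_def Y_def by (simp add: algebra_simps)
  then have det: "X p * Y q - Y p * X q = \<kappa> * cross2 p q" for p q
    unfolding cross2_inner \<kappa>_def by simp
  have "\<kappa> \<noteq> 0" using ab cross2_nonzero by (simp add: \<kappa>_def)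
  have A: "X (A j) > 0" "Y (A j) > 0" "X (A j) < Y (A j)" if "j \<le> k" for j
    using A_pos[OF that] ab by (auto simp: X_def Y_def)
  have B: "X (B j) < 0" "Y (A j) < Y (B j)" if "j \<le> k" for j
    using B_pos[OF that] ab by (auto simp: X_def Y_def mult_less_0_iff)
  have C: "Y (A j) < Y (C j)" "Y (C j) < X (C j)" if "j \<le> k" for j
    using C_pos[OF that] ab by (auto simp: X_def Y_def)
  have S: "X (C j) < X (A (Suc j))" "X (A (Suc j)) - Y (A (Suc j)) < X (B j) - Y (B j)"
    if "Suc j \<le> k" for j
    using A_Suc[OF that] ab by (auto simp: X_def Y_def)
  have double: "2 * Y (A j) < Y (A (Suc j))" if "Suc j \<le> k" for j
    using S[OF that] A[of j] B[of j] C[of j] that by linarith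
  \<comment> \<open>\<open>A 1\<close> lies so far out that \<open>M\<close> dominates the absolute
    values of all four coordinates of \<open>A 0\<close> and \<open>B 0\<close>.\<close>
  define M where "M = Y (A 1)"
  have growth: "Suc j \<le> k \<Longrightarrow> 2 ^ j * M \<le> Y (A (Suc j))" for j
  proof (induction j)
    case (Suc j)
    then show ?case using double[of "Suc j"] by simp
  qed (simp add: M_def)
  have M: "X (A 0) < M" "Y (A 0) < M" "Y (B 0) < M" "- X (B 0) < M" "M > 0"
    using A[of 0] A[of 1] B[of 0] C[of 0] S[of 0] k by (auto simp: M_def)
  have "X (A 0) * Y (B 0) > 0" "Y (A 0) * (- X (B 0)) > 0"
    using A[of 0] B[of 0] by (auto intro!: mult_pos_pos mult_pos_neg)
  then have pos: "\<kappa> * cross2 (A 0) (B 0) > 0"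
    using det[of "A 0" "B 0"] by simp
  then show "cross2 (A 0) (B 0) \<noteq> 0" by auto
  have "X (A 0) * Y (B 0) \<le> M * M" "Y (A 0) * (- X (B 0)) \<le> M * M"
    using M A[of 0] B[of 0] by (intro mult_mono; simp)+
  then have small: "\<kappa> * cross2 (A 0) (B 0) \<le> 2 * M * M"
    using det[of "A 0" "B 0"] by simp
  \<comment> \<open>\<open>X (A k)\<close> is controlled only through \<open>C (k - 1)\<close>,
    hence by \<open>Y (A (k - 1))\<close>. This lag and the start at \<open>A 1\<close> account for
    the 2 in \<open>k = r + 2\<close>.\<close>
  have "X (A k) \<ge> 2 ^ r * M"
    using growth[of r] S[of "Suc r"] C[of "Suc r"] k by simp
  moreover have "Y (B k) \<ge> 2 ^ Suc r * M"
    using growth[of "Suc r"] B[of k] k by simp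
  ultimately have "2 ^ r * M * (2 ^ Suc r * M) \<le> X (A k) * Y (B k)"
    using M A(1)[of k] by (intro mult_mono) auto
  also have "\<dots> \<le> \<kappa> * cross2 (A k) (B k)"
    using det[of "A k" "B k"] A[of k] B[of k] mult_pos_neg[of "Y (A k)" "X (B k)"] by linarith
  finally have "4 ^ r * (2 * M * M) \<le> \<kappa> * cross2 (A k) (B k)"
    by (simp add: algebra_simps flip: power_mult_distrib)
  moreover have "4 ^ r * (\<kappa> * cross2 (A 0) (B 0)) \<le> 4 ^ r * (2 * M * M)"
    using small by simp
  ultimately have "4 ^ r * (\<kappa> * cross2 (A 0) (B 0)) \<le> \<kappa> * cross2 (A k) (B k)"
    by linarith
  \<comment> \<open>The orientation of \<open>v1\<close>, \<open>v2\<close> is unknown, so \<kappa>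
    may be negative and is cancelled in absolute value.\<close>
  then have "4 ^ r * \<bar>\<kappa> * cross2 (A 0) (B 0)\<bar> \<le> \<bar>\<kappa> * cross2 (A k) (B k)\<bar>"
    using pos by linarith
  then have "\<bar>\<kappa>\<bar> * (4 ^ r * \<bar>cross2 (A 0) (B 0)\<bar>) \<le> \<bar>\<kappa>\<bar> * \<bar>cross2 (A k) (B k)\<bar>"
    by (simp add: abs_mult algebra_simps)
  then show "4 ^ r * \<bar>cross2 (A 0) (B 0)\<bar> \<le> \<bar>cross2 (A k) (B k)\<bar>"
    using \<open>\<kappa> \<noteq> 0\<close> by simp
qed

end

section \<open>From vertex orders to the spiral inequalities\<close>

lemma spiral_of_orders:
  fixes pos :: "nat \<Rightarrow> plane"
  assumes ord: "\<And>p q. p < 3 * k + 4 \<Longrightarrow> q < 3 * k + 4 \<Longrightarrow>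
      (spiral_x p < spiral_x q \<longrightarrow> v1 \<bullet> pos p < v1 \<bullet> pos q) \<and>
      (spiral_y p < spiral_y q \<longrightarrow> v2 \<bullet> pos p < v2 \<bullet> pos q) \<and>
      (spiral_z p < spiral_z q \<longrightarrow> v3 \<bullet> pos p < v3 \<bullet> pos q)"
  shows "spiral k (\<lambda>j. pos (3 * j + 1) - pos 0) (\<lambda>j. pos (3 * j + 2) - pos 0)
    (\<lambda>j. pos (3 * j + 3) - pos 0) v1 v2 v3"
proof
  fix j assume j: "j \<le> k"
  show "v1 \<bullet> (pos (3 * j + 1) - pos 0) > 0 \<and> v2 \<bullet> (pos (3 * j + 1) - pos 0) > 0 \<and>
      v3 \<bullet> (pos (3 * j + 1) - pos 0) < 0"
    using ord[of 0 "3 * j + 1"] ord[of "3 * j + 1" 0] j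
    unfolding spiral_values inner_diff_right spiral_0 by simp
  show "v1 \<bullet> (pos (3 * j + 2) - pos 0) < 0 \<and>
      v2 \<bullet> (pos (3 * j + 1) - pos 0) < v2 \<bullet> (pos (3 * j + 2) - pos 0) \<and>
      v3 \<bullet> (pos (3 * j + 2) - pos 0) < 0"
    using ord[of "3 * j + 1" "3 * j + 2"] ord[of "3 * j + 2" 0] j
    unfolding spiral_values inner_diff_right spiral_0 by simp
  show "v1 \<bullet> (pos (3 * j + 3) - pos 0) > 0 \<and>
      v2 \<bullet> (pos (3 * j + 1) - pos 0) < v2 \<bullet> (pos (3 * j + 3) - pos 0) \<and>
      v3 \<bullet> (pos (3 * j + 3) - pos 0) > 0"
    using ord[of "3 * j + 1" "3 * j + 3"] ord[of 0 "3 * j + 3"] j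
    unfolding spiral_values inner_diff_right spiral_0 by (simp add: power_add)
next
  fix j assume j: "Suc j \<le> k"
  \<comment> \<open>Growth by a factor of ten per index beats the multipliers: 4 < 10 for
    \<open>spiral_x\<close>, and 3 < 100 for \<open>spiral_z\<close>.\<close>
  have "spiral_x (3 * j + 3) < spiral_x (3 * Suc j + 1)"
    "spiral_z (3 * Suc j + 1) < spiral_z (3 * j + 2)"
    unfolding spiral_values by (simp_all add: power_add)
  then show "v1 \<bullet> (pos (3 * j + 3) - pos 0) < v1 \<bullet> (pos (3 * Suc j + 1) - pos 0) \<and>
      v3 \<bullet> (pos (3 * Suc j + 1) - pos 0) < v3 \<bullet> (pos (3 * j + 2) - pos 0)"
    using ord[of "3 * j + 3" "3 * Suc j + 1"] ord[of "3 * Suc j + 1" "3 * j + 2"] j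
    unfolding inner_diff_right by simp
qed

section \<open>Areas on the integer grid\<close>

lemma grid_difference:
  assumes "p \<in> integer_grid a b W H" "q \<in> integer_grid a b W H"
  shows "fst (p - q) \<in> \<int>" "snd (p - q) \<in> \<int>"
    "\<bar>fst (p - q)\<bar> \<le> real (max W H)" "\<bar>snd (p - q)\<bar> \<le> real (max W H)"
proof -
  obtain i j where p: "p = (real_of_int i, real_of_int j)"
      "i \<in> {a + 1..a + int W}" "j \<in> {b + 1..b + int H}"
    using assms(1) by (auto simp: integer_grid_def)
  obtain i' j' where q: "q = (real_of_int i', real_of_int j')"
      "i' \<in> {a + 1..a + int W}" "j' \<in> {b + 1..b + int H}"
    using assms(2) by (auto simp: integer_grid_def)
  show "fst (p - q) \<in> \<int>" "snd (p - q) \<in> \<int>" by (simp_all add: p q)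
  have "\<bar>i - i'\<bar> \<le> int (max W H)" "\<bar>j - j'\<bar> \<le> int (max W H)"
    using p q by auto
  then have "real_of_int \<bar>i - i'\<bar> \<le> real_of_int (int (max W H))"
    "real_of_int \<bar>j - j'\<bar> \<le> real_of_int (int (max W H))"
    by (simp_all only: of_int_le_iff)
  then show "\<bar>fst (p - q)\<bar> \<le> real (max W H)" "\<bar>snd (p - q)\<bar> \<le> real (max W H)"
    by (simp_all add: p q)
qed

lemma spiral_grid_bound:
  fixes pos :: "nat \<Rightarrow> plane"
  assumes ord: "\<And>p q. p < 3 * k + 4 \<Longrightarrow> q < 3 * k + 4 \<Longrightarrow>
      (spiral_x p < spiral_x q \<longrightarrow> v1 \<bullet> pos p < v1 \<bullet> pos q) \<and>
      (spiral_y p < spiral_y q \<longrightarrow> v2 \<bullet> pos p < v2 \<bullet> pos q) \<and>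
      (spiral_z p < spiral_z q \<longrightarrow> v3 \<bullet> pos p < v3 \<bullet> pos q)"
    and k: "k = r + 2"
    and grid: "pos ` {..<3 * k + 4} \<subseteq> integer_grid a b W H"
  shows "2 ^ r \<le> 2 * real (max W H)"
proof -
  interpret spiral k "\<lambda>j. pos (3 * j + 1) - pos 0" "\<lambda>j. pos (3 * j + 2) - pos 0"
    "\<lambda>j. pos (3 * j + 3) - pos 0" v1 v2 v3
    by (rule spiral_of_orders) (rule ord)
  let ?N = "real (max W H)"
  have in_grid: "pos p \<in> integer_grid a b W H" if "p < 3 * k + 4" for p
    using grid that by auto
  let ?small = "cross2 (pos (3 * 0 + 1) - pos 0) (pos (3 * 0 + 2) - pos 0)"
  let ?large = "cross2 (pos (3 * k + 1) - pos 0) (pos (3 * k + 2) - pos 0)"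
  have "?small \<in> \<int>"
    unfolding cross2_def by (intro Ints_diff Ints_mult grid_difference[OF in_grid in_grid]) auto
  then have "1 \<le> \<bar>?small\<bar>"
    using cross2_growth(1)[OF k] by (rule Ints_nonzero_abs_ge1)
  then have "4 ^ r \<le> 4 ^ r * \<bar>?small\<bar>" by simp
  also have "\<dots> \<le> \<bar>?large\<bar>" by (rule cross2_growth(2)[OF k])
  also have "\<dots> \<le> ?N * ?N + ?N * ?N"
  proof -
    have N: "\<bar>x * y\<bar> \<le> ?N * ?N" if "\<bar>x\<bar> \<le> ?N" "\<bar>y\<bar> \<le> ?N" for x y :: real
      unfolding abs_mult using that by (intro mult_mono) auto
    show ?thesis
      unfolding cross2_def
      by (intro order_trans[OF abs_triangle_ineq4] add_mono N grid_difference[OF in_grid in_grid])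
        simp_all
  qed
  \<comment> \<open>Rounding up to a perfect square keeps the root free of irrational
    factors.\<close>
  also have "\<dots> \<le> (2 * ?N)\<^sup>2" by (simp add: power2_eq_square)
  also have "4 ^ r = ((2 :: real) ^ r)\<^sup>2"
    by (simp add: power2_eq_square flip: power_mult_distrib)
  finally have "(2 ^ r)\<^sup>2 \<le> (2 * ?N)\<^sup>2" .
  then show ?thesis by (rule power2_le_imp_le) simp
qed

section \<open>The three paths\<close>

lemma spiral_paths:
  assumes k: "k = r + 7"
  shows "\<exists>(V::nat set) Gs.
      finite V \<and> card V = 3 * k + 4 \<and>
      length Gs = 3 \<and> distinct Gs \<and> (\<forall>G \<in> set Gs. directed_spanning_path V G) \<and>
      (\<exists>pos \<gamma>s. monotone_simultaneous_embedding V Gs pos \<gamma>s) \<and>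
      (\<forall>pos \<gamma>s a b W H.
         monotone_simultaneous_embedding V Gs pos \<gamma>s \<and> pos ` V \<subseteq> integer_grid a b W H \<longrightarrow>
         real (max W H) \<ge> (11 / 10) ^ (3 * k + 4))"
proof -
  define V where "V = {..<3 * k + 4}"
  have "finite V" by (simp add: V_def)
  have V: "0 \<in> V" "1 \<in> V" "2 \<in> V" by (auto simp: V_def)
  have inj: "inj_on spiral_x V" "inj_on spiral_y V" "inj_on spiral_z V"
    using inj_spiral inj_on_subset by blast+
  obtain xs where xs: "set xs = V" "distinct xs" "sorted_wrt (\<lambda>a b. spiral_x a < spiral_x b) xs"
    using ex_sorted_list[OF \<open>finite V\<close> inj(1)] by blast
  obtain ys where ys: "set ys = V" "distinct ys" "sorted_wrt (\<lambda>a b. spiral_y a < spiral_y b) ys"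
    using ex_sorted_list[OF \<open>finite V\<close> inj(2)] by blast
  obtain zs where zs: "set zs = V" "distinct zs" "sorted_wrt (\<lambda>a b. spiral_z a < spiral_z b) zs"
    using ex_sorted_list[OF \<open>finite V\<close> inj(3)] by blast
  define Gs where "Gs = map path_graph [xs, ys, zs]"
  have nth: "Gs ! 0 = path_graph xs" "Gs ! 1 = path_graph ys" "Gs ! 2 = path_graph zs"
    "length Gs = 3"
    by (simp_all add: Gs_def)
  \<comment> \<open>The arcs of a path recover its vertex order, so one pair ordered oppositely
    separates two paths.\<close>
  have neq: "path_graph us \<noteq> path_graph ws"
    if "sorted_wrt (\<lambda>a b. f a < f b) us" "sorted_wrt (\<lambda>a b. g a < g b) ws"
      "f p < f q" "g q < g p" "p \<in> set us" "q \<in> set us"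
    for us ws :: "nat list" and f g :: "nat \<Rightarrow> real" and p q
  proof
    assume "path_graph us = path_graph ws"
    then have "set (path_arcs us) = set (path_arcs ws)"
      by (simp add: path_graph_def)
    then have "sorted_wrt (\<lambda>a b. g a < g b) us"
      using path_arcs_sorted[OF that(2)] by (intro sorted_wrt_if_path_arcs) auto
    from sorted_wrt_transfer[OF that(1) this that(5,6,3)] that(4) show False by simp
  qed
  have vals: "spiral_x 1 = 10" "spiral_x 2 = - 100" "spiral_y 1 = 20" "spiral_y 2 = 200"
    "spiral_z 1 = - 10"
    by (simp_all add: spiral_x_def spiral_y_def spiral_z_def)
  have "distinct Gs"
    using neq[OF xs(3) ys(3), of 2 0] neq[OF xs(3) zs(3), of 0 1] neq[OF ys(3) zs(3), of 0 1]
    by (auto simp: Gs_def xs ys zs V vals simp del: One_nat_def)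
  moreover have "\<forall>G\<in>set Gs. directed_spanning_path V G"
  proof -
    have "xs \<noteq> []" "ys \<noteq> []" "zs \<noteq> []" using xs ys zs V by auto
    then show ?thesis
      using directed_spanning_path_path_graph[of xs] directed_spanning_path_path_graph[of ys]
        directed_spanning_path_path_graph[of zs] xs ys zs
      by (simp add: Gs_def)
  qed
  moreover have "\<exists>pos \<gamma>s. monotone_simultaneous_embedding V Gs pos \<gamma>s"
  proof -
    \<comment> \<open>With these coordinates the three orders are those along (1, 0), (0, 1) and (1,
      -1).\<close>
    define pos where "pos m = (spiral_x m, spiral_y m)" for m
    define \<gamma> where "\<gamma> e = linepath (pos (fst e)) (pos (snd e))" for e :: "nat \<times> nat"
    have inner: "(1, 0) \<bullet> pos m = spiral_x m" "(0, 1) \<bullet> pos m = spiral_y m"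
      "(1, - 1) \<bullet> pos m = spiral_z m" for m
      by (simp_all add: pos_def spiral_z_def)
    have "directed_monotone_simultaneous_embedding [(1, 0), (0, 1), (1, - 1)] V Gs pos [\<gamma>, \<gamma>, \<gamma>]"
      unfolding directed_monotone_simultaneous_embedding_def
      using straight_line_drawing[of "(1, 0)" pos xs] straight_line_drawing[of "(0, 1)" pos ys]
        straight_line_drawing[of "(1, - 1)" pos zs] xs ys zs
      by (auto simp: Gs_def inner \<gamma>_def[abs_def] less_Suc_eq numeral_3_eq_3 zero_prod_def)
    then show ?thesis unfolding monotone_simultaneous_embedding_def by blast
  qed
  moreover have "real (max W H) \<ge> (11 / 10) ^ (3 * k + 4)"
    if emb: "monotone_simultaneous_embedding V Gs pos \<gamma>s"
      and grid: "pos ` V \<subseteq> integer_grid a b W H" for pos \<gamma>s a b W H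
  proof -
    obtain vs where vs: "directed_monotone_simultaneous_embedding vs V Gs pos \<gamma>s"
      using emb unfolding monotone_simultaneous_embedding_def by blast
    have arc: "vs ! i \<bullet> pos p < vs ! i \<bullet> pos q" if "i < 3" "(p, q) \<in> parcs (Gs ! i)" for i p q
      using vs that nth(4) unfolding directed_monotone_simultaneous_embedding_def planar_drawing_def
      by (auto intro: monotone_drawing_arc_less)
    have sorted: "sorted_wrt (\<lambda>p q. vs ! 0 \<bullet> pos p < vs ! 0 \<bullet> pos q) xs"
      "sorted_wrt (\<lambda>p q. vs ! 1 \<bullet> pos p < vs ! 1 \<bullet> pos q) ys"
      "sorted_wrt (\<lambda>p q. vs ! 2 \<bullet> pos p < vs ! 2 \<bullet> pos q) zs"
      using arc[of 0] arc[of 1] arc[of 2] by (auto intro!: sorted_wrt_if_path_arcs simp: nth simp del: One_nat_def)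
    have "(spiral_x p < spiral_x q \<longrightarrow> vs ! 0 \<bullet> pos p < vs ! 0 \<bullet> pos q) \<and>
        (spiral_y p < spiral_y q \<longrightarrow> vs ! 1 \<bullet> pos p < vs ! 1 \<bullet> pos q) \<and>
        (spiral_z p < spiral_z q \<longrightarrow> vs ! 2 \<bullet> pos p < vs ! 2 \<bullet> pos q)"
      if "p < 3 * k + 4" "q < 3 * k + 4" for p q
      using sorted_wrt_transfer[OF xs(3) sorted(1)] sorted_wrt_transfer[OF ys(3) sorted(2)]
        sorted_wrt_transfer[OF zs(3) sorted(3)] that xs ys zs by (auto simp: V_def)
    then have "2 ^ (r + 5) \<le> 2 * real (max W H)"
      using k grid by (intro spiral_grid_bound[of k "vs ! 0" pos "vs ! 1" "vs ! 2" "r + 5"])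
        (auto simp: V_def)
    \<comment> \<open>Here \<open>3 * k + 4 = 3 * r + 25\<close>. Each step of \<open>r\<close>
      costs 1.1^3 = 1.331 < 2, and the offset 7 in \<open>k\<close> leaves 2^5 = 32 to cover 2 *
      1.1^25, which is below 22.\<close>
    moreover have "2 * (11 / 10) ^ (3 * k + 4) \<le> (2 :: real) ^ (r + 5)"
    proof -
      have "((11 / 10) ^ 3) ^ r \<le> (2 :: real) ^ r"
        by (intro power_mono) (auto simp: power3_eq_cube)
      moreover have "2 * (11 / 10) ^ 25 \<le> (2 :: real) ^ 5"
        by (simp add: power_divide)
      ultimately have "((11 / 10) ^ 3) ^ r * (2 * (11 / 10) ^ 25) \<le> (2 :: real) ^ r * 2 ^ 5"
        by (intro mult_mono) auto
      moreover have "2 * (11 / 10) ^ (3 * k + 4) = ((11 / 10) ^ 3) ^ r * (2 * (11 / 10 :: real) ^ 25)"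
      proof -
        have "3 * k + 4 = 3 * r + 25" by (simp add: k)
        then show ?thesis by (simp add: power_add power_mult)
      qed
      ultimately show ?thesis by (simp only: power_add)
    qed
    ultimately show ?thesis by linarith
  qed
  ultimately show ?thesis
    using \<open>finite V\<close> nth(4) by (intro exI[of _ V] exI[of _ Gs]) (auto simp: V_def)
qed

theorem proposition11:
  shows "\<exists>c::real. c > 1 \<and>
    infinite {n::nat. \<exists>(V::nat set) (Gs::nat pair_pre_digraph list).
      finite V \<and> card V = n \<and>
      length Gs = 3 \<and> distinct Gs \<and> (\<forall>G \<in> set Gs. directed_spanning_path V G) \<and>
      (\<exists>pos \<gamma>s. monotone_simultaneous_embedding V Gs pos \<gamma>s) \<and>
      (\<forall>pos \<gamma>s a b W H.
         monotone_simultaneous_embedding V Gs pos \<gamma>s \<and> pos ` V \<subseteq> integer_grid a b W H \<longrightarrow>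
         real (max W H) \<ge> c ^ n)}"
    (is "\<exists>c. c > 1 \<and> infinite (?S c)")
proof (intro exI conjI)
  show "(11 / 10 :: real) > 1" by simp
  have "range (\<lambda>r. 3 * (r + 7) + 4) \<subseteq> ?S (11 / 10)"
    using spiral_paths[OF refl] by blast
  moreover have "infinite (range (\<lambda>r::nat. 3 * (r + 7) + 4))"
    by (intro range_inj_infinite injI) simp
  ultimately show "infinite (?S (11 / 10))"
    by (rule infinite_super)
qed

end
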